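(* Let $K$ be an algebraically closed field complete with respect to a non-trivial non-archimedean absolute value, with residue characteristic $p\geq 0$, and assume $\operatorname{char}K=0$ or $\operatorname{char}K>d$. Let $\phi\in K[z]$ be a post-critically finite polynomial of degree $d\geq 2$, and suppose either that $p=0$ or that $\phi$ can be written as a composition of polynomials each of degree less than $p$. Then $\phi$ has potentially good reduction; in particular, $\phi$ has no repelling cycles.
   Context: A polynomial is post-critically finite if every critical point in $\mathbb{P}^1(K)$ has finite forward orbit. $\phi$ has potentially good reduction if there is a change of coordinates $\mu\in\mathrm{PGL}_2(K)$ such that $\mu^{-1}\circ\phi\circ\mu$ has good reduction, i.e. its reduction modulo the maximal ideal of the valuation ring (after normalizing coefficients) has the same degree $d$; for polynomials this means $\phi$ is conjugate by an affine map to a polynomial with coefficients in the valuation ring whose leading coefficient is a unit. A cycle of exact period $n$ is repelling if its multiplier $\lambda=(\phi^n)'(\gamma)$ satisfies $|\lambda|>1$. *)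

theory Defs
  imports Complex_Main "HOL-Computational_Algebra.Polynomial"
begin

section \<open>Complete algebraically closed non-archimedean fields\<close>

text \<open>
  The constant \<^const>\<open>norm\<close> is constrained to real normed vector spaces, which a non-archimedean
  field is not; hence the absolute value is a new class operation, tied to the library's metric
  (and thereby to the library's completeness) by the axiom \<open>dist_vabs\<close>.
\<close>

class nonarch_field = alg_closed_field + complete_space +
  fixes vabs :: "'a \<Rightarrow> real"
  assumes dist_vabs: "dist x y = vabs (x - y)"
    and vabs_mult: "vabs (x * y) = vabs x * vabs y"
    and vabs_ultra: "vabs (x + y) \<le> max (vabs x) (vabs y)"
    and vabs_nontrivial: "\<exists>x. x \<noteq> 0 \<and> vabs x \<noteq> 1"

lemma vabs_eq_0_iff [simp]: "vabs x = 0 \<longleftrightarrow> x = 0"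
  using dist_vabs[of x 0] dist_eq_0_iff[of x 0] by simp

lemma vabs_nonneg [simp]: "0 \<le> vabs x"
  using dist_vabs[of x 0] zero_le_dist[of x 0] by simp

lemma vabs_0 [simp]: "vabs 0 = 0"
  by (simp only: vabs_eq_0_iff)

lemma vabs_1 [simp]: "vabs (1 :: 'a::nonarch_field) = 1"
  using vabs_mult[of "1 :: 'a" 1] by simp

lemma vabs_minus [simp]: "vabs (- x) = vabs x"
  using dist_vabs[of 0 x] dist_vabs[of x 0] dist_commute[of x 0] by simp

lemma vabs_minus_commute: "vabs (x - y) = vabs (y - x)"
  using vabs_minus[of "x - y"] by simp

lemma vabs_inverse: "vabs (inverse x) = inverse (vabs x)"
proof (cases "x = 0")
  case False
  then have "vabs x * vabs (inverse x) = 1"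
    using vabs_mult[of x "inverse x"] by simp
  then show ?thesis by (metis inverse_unique)
qed simp

lemma vabs_add_le: "vabs x \<le> r \<Longrightarrow> vabs y \<le> r \<Longrightarrow> vabs (x + y) \<le> r"
  using vabs_ultra[of x y] by simp

lemma vabs_add_less: "vabs x < r \<Longrightarrow> vabs y < r \<Longrightarrow> vabs (x + y) < r"
  using vabs_ultra[of x y] by simp

text \<open>Congruence modulo the maximal ideal, on the valuation ring.\<close>

definition res_eq :: "'a::nonarch_field \<Rightarrow> 'a \<Rightarrow> bool" where
  "res_eq x y \<longleftrightarrow> vabs x \<le> 1 \<and> vabs y \<le> 1 \<and> vabs (x - y) < 1"

lemma res_eq_refl: "vabs x \<le> 1 \<Longrightarrow> res_eq x x"
  by (simp add: res_eq_def)

lemma res_eq_sym: "res_eq x y \<Longrightarrow> res_eq y x"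
  by (auto simp: res_eq_def vabs_minus_commute)

lemma res_eq_trans: "res_eq x y \<Longrightarrow> res_eq y z \<Longrightarrow> res_eq x z"
  using vabs_add_less[of "x - y" 1 "y - z"] by (auto simp: res_eq_def)

lemma res_eq_add: "res_eq x x' \<Longrightarrow> res_eq y y' \<Longrightarrow> res_eq (x + y) (x' + y')"
  using vabs_add_less[of "x - x'" 1 "y - y'"]
  by (auto simp: res_eq_def vabs_add_le algebra_simps)

lemma res_eq_minus: "res_eq x x' \<Longrightarrow> res_eq (- x) (- x')"
  using vabs_minus[of "x - x'"] by (auto simp: res_eq_def algebra_simps)

lemma res_eq_mult:
  assumes "res_eq x x'" "res_eq y y'"
  shows "res_eq (x * y) (x' * y')"
proof -
  have *: "vabs (u * v) < 1" if "vabs u < 1" "vabs v \<le> 1" for u v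
    using that mult_mono[of "vabs u" "vabs u" "vabs v" 1] by (simp add: vabs_mult)
  have "x * y - x' * y' = (x - x') * y + (y - y') * x'"
    by (simp add: algebra_simps)
  then have "vabs (x * y - x' * y') < 1"
    using assms vabs_add_less[of "(x - x') * y" 1 "(y - y') * x'"]
    by (auto simp: res_eq_def *)
  then show ?thesis
    using assms by (simp add: res_eq_def vabs_mult mult_le_one)
qed

lemma res_eq_unit:
  assumes "res_eq x y" "vabs x = 1"
  shows "vabs y = 1"
proof (rule ccontr)
  assume "vabs y \<noteq> 1"
  then have "vabs ((x - y) + y) < 1"
    using assms by (intro vabs_add_less) (auto simp: res_eq_def)
  then show False using assms(2) by simp
qed

text \<open>Lifts inversion to the residue field; non-units of the valuation ring reduce to \<open>0\<close>.\<close>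

definition res_inv :: "'a::nonarch_field \<Rightarrow> 'a" where
  "res_inv x = (if vabs x = 1 then inverse x else 0)"

lemma res_eq_inv:
  assumes "res_eq x y"
  shows "res_eq (res_inv x) (res_inv y)"
proof (cases "vabs x = 1")
  case True
  then have y: "vabs y = 1" using assms res_eq_unit by blast
  have nz: "x \<noteq> 0" "y \<noteq> 0" using True y by auto
  have "inverse x - inverse y = inverse x * (y - x) * inverse y"
    using nz by (simp add: field_simps)
  then have "vabs (inverse x - inverse y) = vabs (y - x)"
    using True y by (simp add: vabs_mult vabs_inverse)
  then show ?thesis
    using True y assms by (simp add: res_eq_def res_inv_def vabs_inverse vabs_minus_commute)
next
  case False
  then have "vabs y \<noteq> 1" using assms res_eq_unit res_eq_sym by blast
  then show ?thesis using False by (simp add: res_eq_def res_inv_def)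
qed

section \<open>The residue field\<close>

quotient_type (overloaded) 'a residue_field = "'a::nonarch_field" / partial: res_eq
proof (rule part_equivpI)
  show "\<exists>x::'a. res_eq x x" by (rule exI[of _ 0]) (simp add: res_eq_def)
  show "symp (res_eq :: 'a \<Rightarrow> 'a \<Rightarrow> bool)" by (rule sympI) (rule res_eq_sym)
  show "transp (res_eq :: 'a \<Rightarrow> 'a \<Rightarrow> bool)" by (rule transpI) (rule res_eq_trans)
qed

instantiation residue_field :: (nonarch_field) field
begin

lift_definition zero_residue_field :: "'a residue_field" is 0 by (simp add: res_eq_def)
lift_definition one_residue_field :: "'a residue_field" is 1 by (simp add: res_eq_def)
lift_definition plus_residue_field :: "'a residue_field \<Rightarrow> 'a residue_field \<Rightarrow> 'a residue_field"
  is "(+)" by (rule res_eq_add)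
lift_definition uminus_residue_field :: "'a residue_field \<Rightarrow> 'a residue_field"
  is "uminus" by (rule res_eq_minus)
lift_definition minus_residue_field :: "'a residue_field \<Rightarrow> 'a residue_field \<Rightarrow> 'a residue_field"
  is "(-)" using res_eq_add res_eq_minus by (metis add_uminus_conv_diff)
lift_definition times_residue_field :: "'a residue_field \<Rightarrow> 'a residue_field \<Rightarrow> 'a residue_field"
  is "(*)" by (rule res_eq_mult)
lift_definition inverse_residue_field :: "'a residue_field \<Rightarrow> 'a residue_field"
  is res_inv by (rule res_eq_inv)
definition divide_residue_field :: "'a residue_field \<Rightarrow> 'a residue_field \<Rightarrow> 'a residue_field"
  where "divide_residue_field x y = x * inverse y"

instance
proof
  fix a b c :: "'a residue_field"
  show "a + b + c = a + (b + c)"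
    by transfer (simp add: add.assoc res_eq_refl res_eq_def vabs_add_le)
  show "a + b = b + a"
    by transfer (simp add: add.commute res_eq_def vabs_add_le)
  show "0 + a = a" by transfer simp
  show "- a + a = 0" by transfer (simp add: res_eq_def)
  show "a - b = a + - b"
  proof transfer
    fix a b :: 'a
    assume "res_eq a a" "res_eq b b"
    then have "res_eq (a + - b) (a + - b)" by (intro res_eq_add res_eq_minus)
    then show "res_eq (a - b) (a + - b)" by simp
  qed
  show "a * b * c = a * (b * c)"
    by transfer (simp add: mult.assoc res_eq_def vabs_mult mult_le_one)
  show "a * b = b * a"
    by transfer (simp add: mult.commute res_eq_def vabs_mult mult_le_one)
  show "1 * a = a" by transfer simp
  show "(a + b) * c = a * c + b * c"
    by transfer (simp add: distrib_right res_eq_def vabs_add_le vabs_mult mult_le_one)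
  show "(0 :: 'a residue_field) \<noteq> 1" by transfer (simp add: res_eq_def)
  show "a \<noteq> 0 \<Longrightarrow> inverse a * a = 1"
  proof transfer
    fix a :: 'a
    assume "res_eq a a" "\<not> res_eq a 0"
    then have "vabs a = 1" by (auto simp: res_eq_def)
    then show "res_eq (res_inv a * a) 1"
      by (cases "a = 0") (simp_all add: res_eq_def res_inv_def)
  qed
  show "a div b = a * inverse b" by (simp add: divide_residue_field_def)
  show "inverse (0 :: 'a residue_field) = 0" by transfer (simp add: res_eq_def res_inv_def)
qed

end

text \<open>The reduction map is only meaningful on the valuation ring; elsewhere it is set to \<open>0\<close>.\<close>

definition red :: "'a::nonarch_field \<Rightarrow> 'a residue_field" where
  "red x = (if vabs x \<le> 1 then abs_residue_field x else 0)"

lemma red_eq_iff: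
  assumes "vabs x \<le> 1" "vabs y \<le> 1"
  shows "red x = red y \<longleftrightarrow> vabs (x - y) < 1"
proof -
  have "abs_residue_field x = abs_residue_field y \<longleftrightarrow> res_eq x y"
    using Quotient_rel[OF Quotient_residue_field, of x y] res_eq_refl assms by blast
  then show ?thesis using assms by (simp add: red_def res_eq_def)
qed

lemma red_0 [simp]: "red 0 = 0"
  by (simp add: red_def zero_residue_field_def)

lemma red_1 [simp]: "red 1 = 1"
  by (simp add: red_def one_residue_field_def)

lemma red_eq_0_iff: "vabs x \<le> 1 \<Longrightarrow> red x = 0 \<longleftrightarrow> vabs x < 1"
  using red_eq_iff[of x 0] by simp

lemma red_add: "vabs x \<le> 1 \<Longrightarrow> vabs y \<le> 1 \<Longrightarrow> red (x + y) = red x + red y"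
  by (simp add: red_def vabs_add_le plus_residue_field.abs_eq res_eq_refl)

lemma red_mult: "vabs x \<le> 1 \<Longrightarrow> vabs y \<le> 1 \<Longrightarrow> red (x * y) = red x * red y"
  by (simp add: red_def vabs_mult mult_le_one times_residue_field.abs_eq res_eq_refl)

lemma red_surj: "\<exists>x. vabs x \<le> 1 \<and> red x = y"
proof -
  have "res_eq (rep_residue_field y) (rep_residue_field y)"
    by (rule Quotient_rep_reflp[OF Quotient_residue_field])
  then show ?thesis
    by (intro exI[of _ "rep_residue_field y"])
       (simp add: red_def res_eq_def Quotient_abs_rep[OF Quotient_residue_field])
qed

section \<open>Rational maps on the projective line\<close>

datatype 'a proj_line = Finite 'a | Infinity

text \<open>The pair \<open>(F, G)\<close> stands for the rational map \<open>F / G\<close>; \<open>F\<close> and \<open>G\<close> are allowed to have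
  a common factor, because reduction may create one.\<close>

type_synonym 'a ratmap = "'a poly \<times> 'a poly"

text \<open>The degree of \<open>F / G\<close> is read off in lowest terms, i.e. after cancelling the greatest common
  divisor \<open>H\<close>; the pair \<open>(0, 0)\<close> has no degree.\<close>

definition has_degree :: "'a::field ratmap \<Rightarrow> nat \<Rightarrow> bool" where
  "has_degree f d \<longleftrightarrow>
     (\<exists>H A B. H \<noteq> 0 \<and> f = (H * A, H * B) \<and> coprime A B \<and> d = max (degree A) (degree B))"

definition poly_map :: "'a::field poly \<Rightarrow> 'a ratmap" where
  "poly_map \<phi> = (\<phi>, 1)"

text \<open>The remaining operations on \<open>(F, G)\<close> are meant for coprime \<open>F\<close> and \<open>G\<close>, so that
  \<open>max (degree F) (degree G)\<close> is the degree of the map.\<close>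

fun rat_apply :: "'a::field ratmap \<Rightarrow> 'a proj_line \<Rightarrow> 'a proj_line" where
  "rat_apply (F, G) (Finite z) =
     (if poly G z = 0 then Infinity else Finite (poly F z / poly G z))"
| "rat_apply (F, G) Infinity =
     (let d = max (degree F) (degree G)
      in if coeff G d = 0 then Infinity else Finite (coeff F d / coeff G d))"

text \<open>With \<open>F\<^sup>h(X, Y) = (\<Sum>i\<le>d. F\<^sub>i X\<^sup>i Y\<^bsup>d-i\<^esup>)\<close> the homogenisation of \<open>F\<close> in degree \<open>d\<close>,
  \<open>hom_subst d F a b c e\<close> is \<open>F\<^sup>h(a z + b, c z + e)\<close>.\<close>

definition hom_subst :: "nat \<Rightarrow> 'a::field poly \<Rightarrow> 'a \<Rightarrow> 'a \<Rightarrow> 'a \<Rightarrow> 'a \<Rightarrow> 'a poly" where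
  "hom_subst d F a b c e = (\<Sum>i\<le>d. smult (coeff F i) ([:b, a:] ^ i * [:e, c:] ^ (d - i)))"

text \<open>\<open>\<mu>\<^sup>-\<^sup>1 \<circ> f \<circ> \<mu>\<close> for \<open>\<mu>(z) = (a z + b) / (c z + e)\<close>, where \<open>\<mu>\<^sup>-\<^sup>1\<close> is represented by the
  adjugate matrix: \<open>\<mu>\<^sup>-\<^sup>1(w) = (e w - b) / (- c w + a)\<close>.\<close>

fun rat_conj :: "'a::field \<Rightarrow> 'a \<Rightarrow> 'a \<Rightarrow> 'a \<Rightarrow> 'a ratmap \<Rightarrow> 'a ratmap" where
  "rat_conj a b c e (F, G) =
     (let d = max (degree F) (degree G);
          F' = hom_subst d F a b c e;
          G' = hom_subst d G a b c e
      in (smult e F' - smult b G', smult a G' - smult c F'))"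

text \<open>The map is seen in the coordinate \<open>1 / z\<close>, which exchanges \<open>0\<close> and \<open>\<infinity>\<close>.\<close>

abbreviation at_infinity_chart :: "'a::field ratmap \<Rightarrow> 'a ratmap" where
  "at_infinity_chart \<equiv> rat_conj 0 1 1 0"

section \<open>Critical points and post-critical finiteness\<close>

text \<open>The numerator of \<open>(F / G)' = (F' G - F G') / G\<^sup>2\<close>. At a pole of \<open>F / G\<close>, where the target needs
  the coordinate \<open>1 / w\<close>, it is up to sign the numerator of \<open>(G / F)'\<close>; so its zeros are exactly
  the finite critical points.\<close>

fun wronskian :: "'a::field ratmap \<Rightarrow> 'a poly" where
  "wronskian (F, G) = pderiv F * G - F * pderiv G"

fun critical_point :: "'a::field ratmap \<Rightarrow> 'a proj_line \<Rightarrow> bool" where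
  "critical_point f (Finite z) \<longleftrightarrow> poly (wronskian f) z = 0"
| "critical_point f Infinity \<longleftrightarrow> poly (wronskian (at_infinity_chart f)) 0 = 0"

definition post_critically_finite :: "'a::field ratmap \<Rightarrow> bool" where
  "post_critically_finite f \<longleftrightarrow>
     (\<forall>P. critical_point f P \<longrightarrow> finite (range (\<lambda>n. (rat_apply f ^^ n) P)))"

section \<open>Good reduction\<close>

text \<open>\<open>F\<close> and \<open>G\<close> have coefficients in the valuation ring, not all of them in the maximal ideal.\<close>

definition normalized :: "'a::nonarch_field ratmap \<Rightarrow> bool" where
  "normalized f \<longleftrightarrow>
     (\<forall>i. vabs (coeff (fst f) i) \<le> 1 \<and> vabs (coeff (snd f) i) \<le> 1) \<and>
     (\<exists>i. vabs (coeff (fst f) i) = 1 \<or> vabs (coeff (snd f) i) = 1)"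

definition reduction :: "'a::nonarch_field ratmap \<Rightarrow> 'a residue_field ratmap" where
  "reduction f = map_prod (map_poly red) (map_poly red) f"

definition good_reduction :: "'a::nonarch_field ratmap \<Rightarrow> bool" where
  "good_reduction f \<longleftrightarrow>
     (\<exists>d k. k \<noteq> 0 \<and> has_degree f d \<and> normalized (map_prod (smult k) (smult k) f) \<and>
            has_degree (reduction (map_prod (smult k) (smult k) f)) d)"

definition potentially_good_reduction :: "'a::nonarch_field ratmap \<Rightarrow> bool" where
  "potentially_good_reduction f \<longleftrightarrow>
     (\<exists>a b c e. a * e - b * c \<noteq> 0 \<and> good_reduction (rat_conj a b c e f))"

section \<open>Composition and cycles of polynomials\<close>

text \<open>\<open>poly_comp [f\<^sub>1, \<dots>, f\<^sub>r] = f\<^sub>1 \<circ> \<dots> \<circ> f\<^sub>r\<close>\<close>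

definition poly_comp :: "'a::comm_semiring_1 poly list \<Rightarrow> 'a poly" where
  "poly_comp fs = foldr pcompose fs [:0, 1:]"

definition poly_iter :: "'a::comm_semiring_1 poly \<Rightarrow> nat \<Rightarrow> 'a poly" where
  "poly_iter \<phi> n = poly_comp (replicate n \<phi>)"

definition has_exact_period :: "('b \<Rightarrow> 'b) \<Rightarrow> 'b \<Rightarrow> nat \<Rightarrow> bool" where
  "has_exact_period f P n \<longleftrightarrow> n > 0 \<and> (f ^^ n) P = P \<and> (\<forall>m. 0 < m \<and> m < n \<longrightarrow> (f ^^ m) P \<noteq> P)"

text \<open>The derivative of a rational map at a fixed point.\<close>

fun fixed_multiplier :: "'a::field ratmap \<Rightarrow> 'a proj_line \<Rightarrow> 'a" where
  "fixed_multiplier f (Finite z) = poly (wronskian f) z / (poly (snd f) z)\<^sup>2"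
| "fixed_multiplier f Infinity =
     poly (wronskian (at_infinity_chart f)) 0 / (poly (snd (at_infinity_chart f)) 0)\<^sup>2"

definition multiplier :: "'a::field poly \<Rightarrow> nat \<Rightarrow> 'a proj_line \<Rightarrow> 'a" where
  "multiplier \<phi> n P = fixed_multiplier (poly_map (poly_iter \<phi> n)) P"

definition has_repelling_cycle :: "'a::nonarch_field poly \<Rightarrow> bool" where
  "has_repelling_cycle \<phi> \<longleftrightarrow>
     (\<exists>n P. has_exact_period (rat_apply (poly_map \<phi>)) P n \<and> vabs (multiplier \<phi> n P) > 1)"

section \<open>The polynomial case in elementary terms\<close>

lemma rat_apply_poly_map [simp]: "rat_apply (poly_map \<phi>) (Finite z) = Finite (poly \<phi> z)"
  by (simp add: poly_map_def)

lemma rat_apply_poly_map_Infinity [simp]: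
  "degree \<phi> \<ge> 1 \<Longrightarrow> rat_apply (poly_map \<phi>) Infinity = Infinity"
  by (simp add: poly_map_def Let_def)

lemma critical_point_poly_map [simp]:
  "critical_point (poly_map \<phi>) (Finite z) \<longleftrightarrow> poly (pderiv \<phi>) z = 0"
  by (simp add: poly_map_def)

lemma poly_poly_iter: "poly (poly_iter \<phi> n) z = (poly \<phi> ^^ n) z"
  by (induction n) (simp_all add: poly_iter_def poly_comp_def poly_pcompose)

lemma multiplier_Finite [simp]:
  "multiplier \<phi> n (Finite z) = poly (pderiv (poly_iter \<phi> n)) z"
  by (simp add: multiplier_def poly_map_def)

end

theory Submission
  imports Defs
begin

text \<open>
  If all critical values of a tame polynomial lie in a disk, then the preimage of that disk is again
  a disk: otherwise, after rescaling, the reduction of the polynomial would have two distinct roots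
  although all its critical points are roots. This passes to compositions, since the critical
  values of the outer factor are among those of the composition. Now let \<open>w\<close> be a fixed point of
  \<open>\<phi>\<close> and \<open>D\<close> the smallest disk around \<open>w\<close> containing \<open>\<phi>\<^sup>-\<^sup>1(w)\<close>. If \<open>D\<close> is large compared with the
  leading coefficient, then every point outside \<open>D\<close> escapes, so the critical values lie in \<open>D\<close>,
  and \<open>\<phi>\<^sup>-\<^sup>1(D)\<close> is a disk; it contains \<open>\<phi>\<^sup>-\<^sup>1(w)\<close> and hence \<open>D\<close>, but its radius, which is determined by
  the leading coefficient, is too small for that. So \<open>D\<close> is small, and scaling around \<open>w\<close> to make
  \<open>\<phi>\<close> monic also makes it integral.
\<close>

section \<open>Polynomials over a field\<close>

lemma proots_prod_linear [simp]:
  "proots (\<Prod>x\<in>#A. [:- x, 1:]) = (A :: 'a::idom multiset)"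
proof (induction A)
  case (add x A)
  have "(\<Prod>x\<in>#A. [:- x, 1:]) \<noteq> (0 :: 'a poly)" by (auto simp: prod_mset_zero_iff)
  then show ?case using add by (simp add: proots_mult del: mult_pCons_left)
qed simp

lemma degree_prod_linear [simp]:
  "degree (\<Prod>x\<in>#A. [:- x, 1:]) = size (A :: 'a::idom multiset)"
proof (induction A)
  case (add x A)
  have "(\<Prod>x\<in>#A. [:- x, 1:]) \<noteq> (0 :: 'a poly)" by (auto simp: prod_mset_zero_iff)
  then show ?case using add by (simp add: degree_mult_eq del: mult_pCons_left)
qed simp

lemma lead_coeff_prod_linear [simp]:
  "lead_coeff (\<Prod>x\<in>#A. [:- x, 1:]) = (1 :: 'a::idom)"
  by (induction A) (simp_all add: lead_coeff_mult del: mult_pCons_left degree_prod_linear)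

lemma poly_prod_linear: "poly (\<Prod>x\<in>#A. [:- x, 1:]) z = (\<Prod>x\<in>#A. z - (x :: 'a::comm_ring_1))"
  by (induction A) (simp_all add: algebra_simps)

lemma pcompose_prod_linear:
  fixes a b :: "'a::field"
  assumes "b \<noteq> 0"
  shows "pcompose (\<Prod>x\<in>#A. [:- x, 1:]) [:a, b:] =
    smult (b ^ size A) (\<Prod>x\<in>#image_mset (\<lambda>x. (x - a) / b) A. [:- x, 1:])"
proof (induction A)
  case (add x A)
  have "pcompose [:- x, 1:] [:a, b:] = smult b [:- ((x - a) / b), 1:]"
    using assms by (simp add: pcompose_pCons field_simps)
  then show ?case using add by (simp add: pcompose_mult mult.commute del: mult_pCons_left mult_pCons_right smult_pCons)
qed (simp add: one_pCons pcompose_const)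

text \<open>With \<open>n\<close> the multiplicity and \<open>p = L^n * q\<close>, the product rule
  gives \<open>p' = L^n * q' + n * q * L^(n-1)\<close>. If \<open>L^n\<close> divided
  \<open>p'\<close>, then, \<open>n\<close> being invertible, \<open>L\<close> would divide
  \<open>q\<close>.\<close>

lemma order_pderiv_less:
  fixes p :: "'a::field poly"
  assumes "p \<noteq> 0" "pderiv p \<noteq> 0" "poly p x = 0" "of_nat (order x p) \<noteq> (0 :: 'a)"
  shows "order x (pderiv p) < order x p"
proof (rule ccontr)
  define L n where "L = [:- x, 1:]" and "n = order x p"
  assume "\<not> order x (pderiv p) < order x p"
  then have dvd: "L ^ n dvd pderiv p"
    unfolding L_def n_def by (metis linorder_not_less order_1 power_le_dvd)
  obtain q where q: "p = L ^ n * q" "\<not> L dvd q"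
    unfolding L_def n_def using order_decomp assms(1) by blast
  obtain k where k: "n = Suc k"
    using assms(1,3) unfolding n_def by (metis order_root not0_implies_Suc)
  have "pderiv p = L ^ n * pderiv q + smult (of_nat n) (q * L ^ k)"
    unfolding q(1) k L_def by (rule lemma_order_pderiv1)
  then have "L ^ n dvd smult (of_nat n) (q * L ^ k)"
    using dvd by (metis dvd_add_right_iff dvd_triv_left)
  then have "L ^ n dvd q * L ^ k"
    using assms(4) by (simp add: n_def dvd_smult_iff)
  then have "L * L ^ k dvd q * L ^ k" by (simp add: k)
  moreover have "L ^ k \<noteq> 0" by (simp add: L_def)
  ultimately have "L dvd q" using dvd_mult_cancel_right by blast
  with q(2) show False by simp
qed

text \<open>Each root of \<open>p\<close> has smaller multiplicity in \<open>pderiv p\<close>, so there are at most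
  \<open>degree p - card {x. poly p x = 0}\<close> critical points among the roots.\<close>

lemma unique_root_if_critical_points_roots:
  fixes p :: "'a::field poly"
  assumes "degree p > 0"
    and char: "\<And>k. 0 < k \<Longrightarrow> k \<le> degree p \<Longrightarrow> of_nat k \<noteq> (0 :: 'a)"
    and split: "size (proots (pderiv p)) = degree p - 1"
    and crit: "\<And>x. poly (pderiv p) x = 0 \<Longrightarrow> poly p x = 0"
    and "poly p x = 0" "poly p y = 0"
  shows "x = y"
proof -
  define R where "R = {x. poly p x = 0}"
  have nz: "p \<noteq> 0" using assms(1) by auto
  have "coeff (pderiv p) (degree p - 1) = of_nat (degree p) * lead_coeff p"
    using assms(1) by (simp add: coeff_pderiv)
  then have nz': "pderiv p \<noteq> 0"
    using char[of "degree p"] assms(1) nz by auto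
  have fin: "finite R" unfolding R_def using nz by (rule poly_roots_finite)
  \<comment> \<open>Counted with multiplicity, every distinct root costs \<open>pderiv p\<close> at
    least one zero, and by \<open>crit\<close> it has no zeros elsewhere. Since
    \<open>pderiv p\<close> splits, comparing sizes gives \<open>degree p - 1 + card R\<close> at
    most \<open>degree p\<close>.\<close>
  have "proots (pderiv p) + mset_set R \<subseteq># proots p"
  proof (rule mset_subset_eqI)
    fix z
    show "count (proots (pderiv p) + mset_set R) z \<le> count (proots p) z"
    proof (cases "z \<in> R")
      case True
      then have "poly p z = 0" by (simp add: R_def)
      moreover have "0 < order z p" using nz \<open>poly p z = 0\<close> by (metis gr0I order_root)
      moreover have "order z p \<le> degree p" using nz by (rule order_degree)
      ultimately have "order z (pderiv p) < order z p"
        using nz nz' char by (intro order_pderiv_less) auto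
      then show ?thesis using True fin nz nz' by simp
    next
      case False
      then have "poly (pderiv p) z \<noteq> 0" using crit by (auto simp: R_def)
      then have "order z (pderiv p) = 0" by (rule order_0I)
      then show ?thesis using False nz nz' fin by simp
    qed
  qed
  then have "size (proots (pderiv p)) + card R \<le> size (proots p)"
    using size_mset_mono by fastforce
  then have "card R \<le> 1"
    using size_proots_le[of p] split assms(1) by simp
  then show ?thesis
    using assms(5,6) fin card_le_Suc0_iff_eq[OF fin] by (auto simp: R_def)
qed

section \<open>Reduction of integral polynomials\<close>

lemma vabs_pos_iff: "vabs x > 0 \<longleftrightarrow> x \<noteq> 0"
  using vabs_nonneg[of x] vabs_eq_0_iff[of x] by linarith

lemma vabs_power: "vabs (x ^ n) = vabs x ^ n"
  by (induction n) (simp_all add: vabs_mult)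

lemma vabs_divide: "vabs (x / y) = vabs x / vabs y"
  by (simp add: divide_inverse vabs_mult vabs_inverse)

lemma vabs_prod_mset: "vabs (prod_mset A) = (\<Prod>x\<in>#A. vabs x)"
  by (induction A) (simp_all add: vabs_mult)

lemma vabs_diff_le: "vabs x \<le> r \<Longrightarrow> vabs y \<le> r \<Longrightarrow> vabs (x - y) \<le> r"
  using vabs_add_le[of x r "- y"] by simp

lemma vabs_diff_trans: "vabs (x - y) \<le> r \<Longrightarrow> vabs (y - z) \<le> r \<Longrightarrow> vabs (x - z) \<le> r"
  using vabs_add_le[of "x - y" r "y - z"] by simp

lemma vabs_diff_eq:
  assumes "vabs x < vabs z"
  shows "vabs (z - x) = vabs z"
proof (rule antisym)
  show "vabs (z - x) \<le> vabs z" using assms by (intro vabs_diff_le) auto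
  show "vabs z \<le> vabs (z - x)"
    using vabs_ultra[of "z - x" x] assms by simp
qed

lemma vabs_of_nat_le: "vabs (of_nat n :: 'a::nonarch_field) \<le> 1"
  by (induction n) (auto intro: vabs_add_le)

lemma red_of_nat: "red (of_nat n :: 'a::nonarch_field) = of_nat n"
  by (induction n) (simp_all add: red_add vabs_of_nat_le)

section \<open>Integral polynomials and coefficientwise reduction\<close>

definition integral_poly :: "'a::nonarch_field poly \<Rightarrow> bool" where
  "integral_poly f \<longleftrightarrow> (\<forall>i. vabs (coeff f i) \<le> 1)"

lemma integral_poly_pCons [simp]:
  "integral_poly (pCons a f) \<longleftrightarrow> vabs a \<le> 1 \<and> integral_poly f"
  by (force simp: integral_poly_def coeff_pCons split: nat.splits)

lemma integral_poly_0 [simp]: "integral_poly 0"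
  by (simp add: integral_poly_def)

lemma integral_poly_1 [simp]: "integral_poly 1"
  by (simp add: one_pCons)

lemma integral_poly_add: "integral_poly f \<Longrightarrow> integral_poly g \<Longrightarrow> integral_poly (f + g)"
  by (simp add: integral_poly_def vabs_add_le)

lemma integral_poly_smult: "vabs a \<le> 1 \<Longrightarrow> integral_poly f \<Longrightarrow> integral_poly (smult a f)"
  by (simp add: integral_poly_def vabs_mult mult_le_one)

lemma integral_poly_mult: "integral_poly f \<Longrightarrow> integral_poly g \<Longrightarrow> integral_poly (f * g)"
  by (induction f) (simp_all add: integral_poly_add integral_poly_smult)

lemma integral_poly_pderiv: "integral_poly f \<Longrightarrow> integral_poly (pderiv f)"
  by (induction f) (simp_all add: pderiv_pCons integral_poly_add)

lemma integral_poly_prod_linear: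
  "(\<And>x. x \<in># A \<Longrightarrow> vabs x \<le> 1) \<Longrightarrow> integral_poly (\<Prod>x\<in>#A. [:- x, 1:])"
  by (induction A) (simp_all add: integral_poly_mult del: mult_pCons_left)

lemma vabs_poly_le: "integral_poly f \<Longrightarrow> vabs x \<le> 1 \<Longrightarrow> vabs (poly f x) \<le> 1"
  by (induction f) (simp_all add: vabs_add_le vabs_mult mult_le_one)

abbreviation red_poly :: "'a::nonarch_field poly \<Rightarrow> 'a residue_field poly" where
  "red_poly \<equiv> map_poly red"

lemma red_poly_add: "integral_poly f \<Longrightarrow> integral_poly g \<Longrightarrow> red_poly (f + g) = red_poly f + red_poly g"
  by (rule poly_eqI) (simp add: integral_poly_def coeff_map_poly red_add)

lemma red_poly_smult: "vabs a \<le> 1 \<Longrightarrow> integral_poly f \<Longrightarrow> red_poly (smult a f) = smult (red a) (red_poly f)"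
  by (rule poly_eqI) (simp add: integral_poly_def coeff_map_poly red_mult)

lemma red_poly_pCons: "red_poly (pCons a f) = pCons (red a) (red_poly f)"
  by (rule poly_eqI) (simp add: coeff_map_poly coeff_pCons split: nat.splits)

lemma red_poly_mult:
  "integral_poly f \<Longrightarrow> integral_poly g \<Longrightarrow> red_poly (f * g) = red_poly f * red_poly g"
  by (induction f)
    (simp_all add: red_poly_pCons red_poly_add red_poly_smult integral_poly_mult integral_poly_smult)

lemma red_poly_pderiv: "integral_poly f \<Longrightarrow> red_poly (pderiv f) = pderiv (red_poly f)"
  by (induction f) (simp_all add: pderiv_pCons red_poly_pCons red_poly_add integral_poly_pderiv)

lemma red_minus: "vabs x \<le> 1 \<Longrightarrow> red (- x) = - red x"
  using red_add[of x "- x"] by (simp add: add_eq_0_iff)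

lemma red_poly_prod_linear:
  "(\<And>x. x \<in># A \<Longrightarrow> vabs x \<le> 1) \<Longrightarrow>
    red_poly (\<Prod>x\<in>#A. [:- x, 1:]) = (\<Prod>x\<in>#image_mset red A. [:- x, 1:])"
  by (induction A)
    (simp_all add: red_poly_mult integral_poly_prod_linear red_poly_pCons red_minus one_pCons
      del: mult_pCons_left)

lemma red_poly_eval: "integral_poly f \<Longrightarrow> vabs x \<le> 1 \<Longrightarrow> red (poly f x) = poly (red_poly f) (red x)"
  by (induction f)
    (simp_all add: red_poly_pCons red_add red_mult vabs_poly_le vabs_mult mult_le_one)

section \<open>Preimages of disks under tame polynomials\<close>

text \<open>For positive degree this says that the residue characteristic is 0 or exceeds the
  degree. The form with \<open>of_nat\<close> is the one that the multiplicity count over the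
  residue field consumes.\<close>

definition tame :: "'a::nonarch_field poly \<Rightarrow> bool" where
  "tame f \<longleftrightarrow> degree f > 0 \<and>
     (\<forall>k. 0 < k \<and> k \<le> degree f \<longrightarrow> (of_nat k :: 'a residue_field) \<noteq> 0)"

lemma tame_same_degree: "tame f \<Longrightarrow> degree g = degree f \<Longrightarrow> tame g"
  for f g :: "'a::nonarch_field poly"
  by (simp add: tame_def)

lemma tame_of_nat:
  fixes f :: "'a::nonarch_field poly"
  assumes "tame f" "0 < k" "k \<le> degree f"
  shows "of_nat k \<noteq> (0 :: 'a)"
  using assms red_of_nat[of k, where 'a = 'a] by (auto simp: tame_def)

text \<open>The reduction \<open>H\<close> of \<open>h\<close> splits with roots
  \<open>red x\<close> for \<open>x\<close> in \<open>A\<close>. Its critical points are reductions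
  of critical points of \<open>h\<close>, so \<open>crit\<close> turns them into roots of
  \<open>H\<close>, and the multiplicity count leaves \<open>H\<close> a single root.\<close>

lemma roots_residually_equal:
  fixes A :: "'a::nonarch_field multiset"
  defines "h \<equiv> \<Prod>x\<in>#A. [:- x, 1:]"
  assumes le: "\<And>x. x \<in># A \<Longrightarrow> vabs x \<le> 1"
    and tame: "tame h"
    and crit: "\<And>z. poly (pderiv h) z = 0 \<Longrightarrow> vabs (poly h z) < 1"
    and xy: "x \<in># A" "y \<in># A"
  shows "vabs (x - y) < 1"
proof -
  define m where "m = size A"
  have deg: "degree h = m" by (simp add: h_def m_def)
  have m: "m > 0" using tame deg by (simp add: tame_def)
  have int: "integral_poly h" unfolding h_def using le by (rule integral_poly_prod_linear)
  have m0: "of_nat m \<noteq> (0 :: 'a)" using tame_of_nat[OF tame m] deg by simp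
  have mr: "of_nat m \<noteq> (0 :: 'a residue_field)" using tame m deg by (auto simp: tame_def)
  have top: "coeff (pderiv h) (m - 1) = of_nat m"
    using m deg lead_coeff_prod_linear[of A] by (simp add: coeff_pderiv h_def m_def)
  have nz': "pderiv h \<noteq> 0" using top m0 by auto
  have deg': "degree (pderiv h) = m - 1"
  proof (rule antisym)
    show "degree (pderiv h) \<le> m - 1"
      using m deg by (intro degree_le allI impI) (simp add: coeff_pderiv coeff_eq_0)
    show "m - 1 \<le> degree (pderiv h)" using top m0 by (intro le_degree) simp
  qed
  obtain B where B: "size B = m - 1" "pderiv h = smult (of_nat m) (\<Prod>x\<in>#B. [:- x, 1:])"
    using alg_closed_imp_factorization[OF nz'] deg' top by auto
  have root: "vabs (poly h z) < 1" if "z \<in># B" for z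
  proof (rule crit)
    show "poly (pderiv h) z = 0"
      unfolding B(2) using that by (auto simp: poly_prod_linear prod_mset_zero_iff)
  qed
  \<comment> \<open>Outside the unit disk all factors of \<open>h\<close> have absolute value
    \<open>vabs z\<close>, so the value of \<open>h\<close> there is too large for a critical
    value.\<close>
  have B_le: "vabs z \<le> 1" if "z \<in># B" for z
  proof (rule ccontr)
    assume *: "\<not> vabs z \<le> 1"
    have "vabs (poly h z) = (\<Prod>x\<in>#A. vabs (z - x))"
      by (simp add: h_def poly_prod_linear vabs_prod_mset image_mset.compositionality o_def)
    also have "\<dots> = (\<Prod>x\<in>#A. vabs z)"
      using le * by (intro arg_cong[of _ _ prod_mset] image_mset_cong vabs_diff_eq) force
    also have "\<dots> \<ge> 1" using * by (simp add: one_le_power)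
    finally show False using root[OF that] by simp
  qed
  define H where "H = red_poly h"
  have H: "H = (\<Prod>x\<in>#image_mset red A. [:- x, 1:])"
    unfolding H_def h_def using le by (rule red_poly_prod_linear)
  have degH: "degree H = m" unfolding H degree_prod_linear by (simp add: m_def)
  \<comment> \<open>As \<open>m\<close> is a unit residually, reduction keeps the degree of the
    derivative, and the splitting of \<open>pderiv H\<close> is inherited from that of
    \<open>pderiv h\<close>.\<close>
  have "pderiv H = red_poly (smult (of_nat m) (\<Prod>x\<in>#B. [:- x, 1:]))"
    unfolding H_def B(2)[symmetric] using int by (simp add: red_poly_pderiv)
  also have "\<dots> = smult (of_nat m) (\<Prod>x\<in>#image_mset red B. [:- x, 1:])"
    using B_le red_poly_prod_linear[of B]
    by (simp add: red_poly_smult vabs_of_nat_le integral_poly_prod_linear red_of_nat)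
  finally have pH: "pderiv H = \<dots>" .
  have prH: "proots (pderiv H) = image_mset red B"
    unfolding pH proots_smult[OF mr] by (rule proots_prod_linear)
  have rootsH: "poly H (red z) = 0" if "z \<in># A" for z
    unfolding H poly_prod_linear using that by (auto simp: prod_mset_zero_iff)
  have "red x = red y"
  proof (rule unique_root_if_critical_points_roots[of H])
    show "degree H > 0" using degH m by simp
    show "of_nat k \<noteq> (0 :: 'a residue_field)" if "0 < k" "k \<le> degree H" for k
      using that tame deg degH by (auto simp: tame_def)
    show "size (proots (pderiv H)) = degree H - 1"
      by (simp add: prH B(1) degH)
    show "poly H u = 0" if "poly (pderiv H) u = 0" for u
    proof -
      have "pderiv H \<noteq> 0" unfolding pH using mr by (auto simp: prod_mset_zero_iff)
      then have "u \<in># proots (pderiv H)" using that by simp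
      then obtain z where z: "z \<in># B" "u = red z" by (auto simp: prH)
      have "poly H u = red (poly h z)"
        using z B_le int by (simp add: H_def red_poly_eval)
      also have "\<dots> = 0" using root[OF z(1)] by (simp add: red_eq_0_iff)
      finally show ?thesis .
    qed
  qed (use xy rootsH in auto)
  then show ?thesis using xy le by (simp add: red_eq_iff)
qed

text \<open>The formula for the radius \<open>r\<close> is stable under composition.\<close>

definition disk_preimage :: "'a::nonarch_field poly \<Rightarrow> bool" where
  "disk_preimage f \<longleftrightarrow> degree f > 0 \<and>
    (\<forall>c s. s > 0 \<longrightarrow> (\<forall>z. poly (pderiv f) z = 0 \<longrightarrow> vabs (poly f z - c) \<le> s) \<longrightarrow>
      (\<exists>a r. r > 0 \<and> vabs (lead_coeff f) * r ^ degree f = s \<and>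
        (\<forall>z. vabs (poly f z - c) \<le> s \<longleftrightarrow> vabs (z - a) \<le> r)))"

section \<open>From factorizations of \<open>f - [:c:]\<close> to preimages of disks\<close>

lemma degree_diff_const: "degree f > 0 \<Longrightarrow> degree (f - [:c:]) = degree f"
  for f :: "'a::ab_group_add poly"
  unfolding diff_conv_add_uminus by (rule degree_add_eq_left) simp

lemma poly_factorization_value:
  fixes f :: "'a::alg_closed_field poly"
  assumes "degree f > 0"
  obtains A where "size A = degree f" "f - [:c:] = smult (lead_coeff f) (\<Prod>x\<in>#A. [:- x, 1:])"
proof -
  have deg: "degree (f - [:c:]) = degree f"
    using assms by (rule degree_diff_const)
  moreover have "lead_coeff (f - [:c:]) = lead_coeff f"
    using assms unfolding deg by (auto simp: coeff_pCons split: nat.splits)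
  moreover have "f - [:c:] \<noteq> 0" using deg assms by auto
  ultimately show ?thesis using alg_closed_imp_factorization[of "f - [:c:]"] that by metis
qed

lemma prod_mset_mono_const:
  fixes g :: "'b \<Rightarrow> real"
  assumes "\<And>x. x \<in># A \<Longrightarrow> 0 \<le> g x \<and> g x \<le> r"
  shows "0 \<le> (\<Prod>x\<in>#A. g x) \<and> (\<Prod>x\<in>#A. g x) \<le> r ^ size A"
  using assms by (induction A) (auto intro!: mult_mono order_trans[of 0 "g _" r])

text \<open>All roots of \<open>f - [:c:]\<close> lie within \<open>r\<close> of any one of them,
  \<open>a\<close>; otherwise rescaling by the largest distance contradicts
  \<open>roots_residually_equal\<close>. The value at \<open>z\<close> is the product of the
  distances to the roots, so comparing \<open>vabs (z - a)\<close> with \<open>r\<close> decides its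
  size.\<close>

lemma tame_disk_preimage:
  fixes f :: "'a::nonarch_field poly"
  assumes tame: "tame f"
  shows "disk_preimage f"
  unfolding disk_preimage_def
proof (intro conjI allI impI)
  show dpos: "degree f > 0" using tame by (simp add: tame_def)
  fix c :: 'a and s :: real
  assume s: "s > 0" and crit: "\<forall>z. poly (pderiv f) z = 0 \<longrightarrow> vabs (poly f z - c) \<le> s"
  define m l where "m = degree f" and "l = lead_coeff f"
  have l: "vabs l > 0" using dpos by (auto simp: l_def vabs_pos_iff)
  obtain A where A: "size A = m" "f - [:c:] = smult l (\<Prod>x\<in>#A. [:- x, 1:])"
    using poly_factorization_value[OF dpos] by (auto simp: m_def l_def)
  have m: "m > 0" using dpos by (simp add: m_def)
  then obtain a where a: "a \<in># A" using A(1) by fastforce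
  \<comment> \<open>The formula relating radius and leading coefficient forces this value.\<close>
  define r where "r = root m (s / vabs l)"
  have r: "r > 0" "vabs l * r ^ m = s"
    using m l s by (auto simp: r_def real_root_pow_pos2)
  have close: "vabs (b - a) \<le> r" if "b \<in># A" for b
  proof (rule ccontr)
    assume "\<not> vabs (b - a) \<le> r"
    define M where "M = Max (vabs ` (\<lambda>x. x - a) ` set_mset A)"
    have M_le: "vabs (x - a) \<le> M" if "x \<in># A" for x
      unfolding M_def using that by (intro Max_ge) auto
    have "M \<in> vabs ` (\<lambda>x. x - a) ` set_mset A"
      unfolding M_def using a by (intro Max_in) auto
    then obtain b' where b': "b' \<in># A" "vabs (b' - a) = M" by auto
    have "M > r" using M_le[OF that] \<open>\<not> vabs (b - a) \<le> r\<close> by simp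
    \<comment> \<open>Sending \<open>a\<close> to 0 and a farthest root \<open>b'\<close> to 1 puts
      all roots in the unit disk, with 0 and 1 among them.\<close>
    define \<beta> where "\<beta> = b' - a"
    have \<beta>: "vabs \<beta> = M" "\<beta> \<noteq> 0"
      using b' \<open>M > r\<close> r by (auto simp: \<beta>_def)
    define B where "B = image_mset (\<lambda>x. (x - a) / \<beta>) A"
    define h where "h = (\<Prod>x\<in>#B. [:- x, 1:])"
    have fh: "pcompose (f - [:c:]) [:a, \<beta>:] = smult (l * \<beta> ^ m) h"
      unfolding A(2) pcompose_smult pcompose_prod_linear[OF \<beta>(2)] by (simp add: h_def B_def A(1))
    \<comment> \<open>Because \<open>M > r\<close>, the new leading coefficient exceeds
      \<open>s\<close>; dividing by it makes the critical values of \<open>h\<close> strictly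
      smaller than 1.\<close>
    have big: "s < vabs (l * \<beta> ^ m)"
      using l r \<open>M > r\<close> m \<beta> by (simp add: vabs_mult vabs_power power_strict_mono flip: r(2))
    have "vabs ((b' - a) / \<beta> - (a - a) / \<beta>) < 1"
    proof (rule roots_residually_equal)
      show "vabs x \<le> 1" if "x \<in># B" for x
        using that M_le \<beta> \<open>M > r\<close> r by (auto simp: B_def vabs_divide)
      show "tame (\<Prod>x\<in>#B. [:- x, 1:])"
        using tame by (rule tame_same_degree) (simp add: B_def A(1) m_def)
      show "(b' - a) / \<beta> \<in># B" "(a - a) / \<beta> \<in># B" using a b' by (auto simp: B_def)
      fix z assume "poly (pderiv (\<Prod>x\<in>#B. [:- x, 1:])) z = 0"
      then have "poly (pderiv (pcompose (f - [:c:]) [:a, \<beta>:])) z = 0"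
        unfolding fh by (simp add: pderiv_smult h_def)
      then have "poly (pderiv f) (a + \<beta> * z) = 0"
        using \<beta>(2) by (simp add: pderiv_pcompose poly_pcompose pderiv_diff pderiv_pCons mult.commute)
      then have "vabs (poly f (a + \<beta> * z) - c) \<le> s" using crit by blast
      also have "poly f (a + \<beta> * z) - c = (l * \<beta> ^ m) * poly h z"
        using arg_cong[OF fh, of "\<lambda>q. poly q z"] by (simp add: poly_pcompose mult.commute)
      finally have "vabs (l * \<beta> ^ m) * vabs (poly h z) \<le> s" by (simp only: vabs_mult)
      then have "vabs (l * \<beta> ^ m) * vabs (poly h z) < vabs (l * \<beta> ^ m) * 1" using big by linarith
      then show "vabs (poly (\<Prod>x\<in>#B. [:- x, 1:]) z) < 1"
        unfolding h_def by (rule mult_left_less_imp_less) simp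
    qed
    then show False using \<beta>(2) by (simp add: \<beta>_def)
  qed
  have val: "vabs (poly f z - c) = vabs l * (\<Prod>x\<in>#A. vabs (z - x))" for z
    using arg_cong[OF A(2), of "\<lambda>q. vabs (poly q z)"]
    by (simp add: poly_prod_linear vabs_mult vabs_prod_mset image_mset.compositionality o_def)
  have "vabs (poly f z - c) \<le> s \<longleftrightarrow> vabs (z - a) \<le> r" for z
  proof
    assume z: "vabs (z - a) \<le> r"
    have "(\<Prod>x\<in>#A. vabs (z - x)) \<le> r ^ size A"
      using z close vabs_diff_trans[of z a r] by (intro conjunct2[OF prod_mset_mono_const]) (auto simp: vabs_minus_commute)
    then show "vabs (poly f z - c) \<le> s" using l by (simp add: val A(1) flip: r(2))
  next
    assume le: "vabs (poly f z - c) \<le> s"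
    show "vabs (z - a) \<le> r"
    proof (rule ccontr)
      assume *: "\<not> vabs (z - a) \<le> r"
      \<comment> \<open>Seen from outside the disk, all roots are equally far away.\<close>
      have "vabs (z - x) = vabs (z - a)" if "x \<in># A" for x
        using vabs_diff_eq[of "x - a" "z - a"] close[OF that] * by simp
      then have "(\<Prod>x\<in>#A. vabs (z - x)) = vabs (z - a) ^ m"
        by (simp add: A(1) cong: image_mset_cong)
      moreover have "r ^ m < vabs (z - a) ^ m" using * r m by (intro power_strict_mono) auto
      ultimately show False using le l by (simp add: val flip: r(2))
    qed
  qed
  then show "\<exists>a r. r > 0 \<and> vabs (lead_coeff f) * r ^ degree f = s \<and>
      (\<forall>z. vabs (poly f z - c) \<le> s \<longleftrightarrow> vabs (z - a) \<le> r)"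
    using r by (auto simp: m_def l_def)
qed

text \<open>Any critical point \<open>x\<close> of \<open>f\<close> equals \<open>g z\<close> for
  some \<open>z\<close>, which is then critical for the composition. So the disk can be pulled back
  first by \<open>f\<close> and then by \<open>g\<close>.\<close>

lemma disk_preimage_pcompose:
  fixes f g :: "'a::nonarch_field poly"
  assumes f: "disk_preimage f" and g: "disk_preimage g"
  shows "disk_preimage (pcompose f g)"
  unfolding disk_preimage_def
proof (intro conjI allI impI)
  show "degree (pcompose f g) > 0"
    using f g by (simp add: disk_preimage_def degree_pcompose)
  fix c :: 'a and s :: real
  assume s: "s > 0"
    and crit: "\<forall>z. poly (pderiv (pcompose f g)) z = 0 \<longrightarrow> vabs (poly (pcompose f g) z - c) \<le> s"
  have deg: "degree f > 0" "degree g > 0" using f g by (auto simp: disk_preimage_def)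
  have "vabs (poly f x - c) \<le> s" if x: "poly (pderiv f) x = 0" for x
  proof -
    obtain z where "poly (g - [:x:]) z = 0"
      using alg_closed_imp_poly_has_root[of "g - [:x:]"] deg(2)
      by (auto simp: degree_diff_const)
    then have "poly g z = x" by simp
    then show ?thesis using crit x by (auto simp: pderiv_pcompose poly_pcompose)
  qed
  then obtain a r where a: "r > 0" "vabs (lead_coeff f) * r ^ degree f = s"
      "\<And>z. vabs (poly f z - c) \<le> s \<longleftrightarrow> vabs (z - a) \<le> r"
    using f s unfolding disk_preimage_def by metis
  \<comment> \<open>Critical points of \<open>g\<close> are critical for the composition too; their
    images under \<open>g\<close> therefore lie in the first preimage disk.\<close>
  have "vabs (poly g z - a) \<le> r" if "poly (pderiv g) z = 0" for z
    using crit that by (simp add: pderiv_pcompose poly_pcompose flip: a(3))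
  then obtain b q where b: "q > 0" "vabs (lead_coeff g) * q ^ degree g = r"
      "\<And>z. vabs (poly g z - a) \<le> r \<longleftrightarrow> vabs (z - b) \<le> q"
    using g a(1) unfolding disk_preimage_def by metis
  have "vabs (lead_coeff (pcompose f g)) * q ^ degree (pcompose f g) = s"
    unfolding lead_coeff_comp[OF deg(2)]
    unfolding degree_pcompose a(2)[symmetric] b(2)[symmetric]
    by (simp add: vabs_mult vabs_power power_mult_distrib power_mult mult.commute[of "degree f"])
  moreover have "vabs (poly (pcompose f g) z - c) \<le> s \<longleftrightarrow> vabs (z - b) \<le> q" for z
    by (simp add: poly_pcompose a(3) b(3))
  ultimately show "\<exists>a r. r > 0 \<and> vabs (lead_coeff (pcompose f g)) * r ^ degree (pcompose f g) = s \<and>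
      (\<forall>z. vabs (poly (pcompose f g) z - c) \<le> s \<longleftrightarrow> vabs (z - a) \<le> r)"
    using b(1) by blast
qed

text \<open>Tameness is asked of nonconstant factors only: the positive degree of the composition
  excludes constant ones.\<close>

lemma disk_preimage_poly_comp:
  fixes fs :: "'a::nonarch_field poly list"
  assumes "\<And>f. f \<in> set fs \<Longrightarrow> degree f > 0 \<Longrightarrow> tame f" "degree (poly_comp fs) > 0"
  shows "disk_preimage (poly_comp fs)"
  using assms
proof (induction fs)
  case Nil
  have "disk_preimage ([:0, 1:] :: 'a poly)"
    by (auto simp: disk_preimage_def)
  then show ?case by (simp add: poly_comp_def)
next
  case (Cons f fs)
  then have "degree f > 0" "degree (poly_comp fs) > 0"
    by (simp_all add: poly_comp_def degree_pcompose)
  then have "disk_preimage (pcompose f (poly_comp fs))"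
    using Cons by (intro disk_preimage_pcompose[OF tame_disk_preimage]) auto
  then show ?case by (simp add: poly_comp_def)
qed

section \<open>Orbits and good reduction\<close>

lemma rat_apply_funpow_Finite [simp]:
  "(rat_apply (poly_map \<phi>) ^^ n) (Finite z) = Finite ((poly \<phi> ^^ n) z)"
  by (induction n) simp_all

text \<open>Moving away from \<open>w\<close> keeps a point outside the disk, so the growth repeats.
  This excludes both finite and periodic orbits there.\<close>

lemma strict_mono_escaping_orbit:
  fixes f :: "'a::nonarch_field \<Rightarrow> 'a"
  assumes "\<And>z. vabs (z - w) > M \<Longrightarrow> vabs (f z - w) > vabs (z - w)" "vabs (z - w) > M"
  shows "strict_mono (\<lambda>n. vabs ((f ^^ n) z - w))"
proof -
  have "vabs ((f ^^ n) z - w) > M" for n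
    by (induction n) (use assms in \<open>auto intro: less_trans\<close>)
  then show ?thesis by (simp add: strict_mono_Suc_iff assms(1))
qed

lemma poly_outside_roots:
  fixes \<phi> :: "'a::nonarch_field poly"
  assumes fac: "\<phi> - [:w:] = smult l (\<Prod>x\<in>#A. [:- x, 1:])"
    and roots: "\<And>x. x \<in># A \<Longrightarrow> vabs (x - w) \<le> M"
    and z: "vabs (z - w) > M"
  shows "vabs (poly \<phi> z - w) = vabs l * vabs (z - w) ^ size A"
proof -
  have "vabs (poly \<phi> z - w) = vabs l * (\<Prod>x\<in>#A. vabs (z - x))"
    using arg_cong[OF fac, of "\<lambda>q. vabs (poly q z)"]
    by (simp add: poly_prod_linear vabs_mult vabs_prod_mset image_mset.compositionality o_def)
  moreover have "vabs (z - x) = vabs (z - w)" if "x \<in># A" for x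
    using vabs_diff_eq[of "x - w" "z - w"] roots[OF that] z by simp
  ultimately show ?thesis by (simp cong: image_mset_cong)
qed

text \<open>Outside the disk the distance to \<open>w\<close> is multiplied by
  \<open>vabs l * vabs (z - w) ^ (size A - 1)\<close>, which exceeds its value at radius
  \<open>M\<close>, hence 1.\<close>

lemma poly_escapes:
  fixes \<phi> :: "'a::nonarch_field poly"
  assumes fac: "\<phi> - [:w:] = smult l (\<Prod>x\<in>#A. [:- x, 1:])" and size: "size A \<ge> 2"
    and roots: "\<And>x. x \<in># A \<Longrightarrow> vabs (x - w) \<le> M"
    and M: "M \<ge> 0" "vabs l * M ^ (size A - 1) \<ge> 1"
    and z: "vabs (z - w) > M"
  shows "vabs (poly \<phi> z - w) > vabs (z - w)"
proof -
  have l: "vabs l > 0" using M(2) by (cases "l = 0") (auto simp: vabs_pos_iff)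
  have "M ^ (size A - 1) < vabs (z - w) ^ (size A - 1)"
    using M(1) z size by (intro power_strict_mono) auto
  then have "1 < vabs l * vabs (z - w) ^ (size A - 1)"
    using M(2) l by (meson less_le_trans le_less_trans mult_strict_left_mono)
  then have "1 * vabs (z - w) < vabs l * vabs (z - w) ^ (size A - 1) * vabs (z - w)"
    using M(1) z by (intro mult_strict_right_mono) auto
  also have "\<dots> = vabs l * vabs (z - w) ^ size A"
    using size by (cases "size A") auto
  also have "\<dots> = vabs (poly \<phi> z - w)"
    using poly_outside_roots[OF fac roots z] by simp
  finally show ?thesis by simp
qed

text \<open>Let \<open>M\<close> be the largest distance from \<open>w\<close> to a root. If the
  bound fails, points beyond \<open>M\<close> escape, so all critical values lie within
  \<open>M\<close> of \<open>w\<close>. The preimage of that disk has a radius \<open>r\<close> with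
  \<open>vabs l * r ^ d = M\<close>; it contains \<open>A\<close>, so \<open>M \<le> r\<close>,
  which contradicts \<open>vabs l * M ^ (d - 1) > 1\<close>.\<close>

lemma pcf_root_bound:
  fixes \<phi> :: "'a::nonarch_field poly"
  assumes disk: "disk_preimage \<phi>" and pcf: "post_critically_finite (poly_map \<phi>)"
    and fac: "\<phi> - [:w:] = smult (lead_coeff \<phi>) (\<Prod>x\<in>#A. [:- x, 1:])"
    and size: "size A = degree \<phi>" "degree \<phi> \<ge> 2"
    and "w \<in># A" "b \<in># A"
  shows "vabs (lead_coeff \<phi>) * vabs (b - w) ^ (degree \<phi> - 1) \<le> 1"
proof (rule ccontr)
  define l d where "l = lead_coeff \<phi>" and "d = degree \<phi>"
  define M where "M = Max (vabs ` (\<lambda>x. x - w) ` set_mset A)"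
  assume "\<not> ?thesis"
  then have gt: "vabs l * vabs (b - w) ^ (d - 1) > 1" by (simp add: l_def d_def)
  have M_le: "vabs (x - w) \<le> M" if "x \<in># A" for x
    unfolding M_def using that by (intro Max_ge) auto
  have "M \<in> vabs ` (\<lambda>x. x - w) ` set_mset A"
    unfolding M_def using assms(6) by (intro Max_in) auto
  then obtain b' where b': "b' \<in># A" "vabs (b' - w) = M" by auto
  have "vabs l * vabs (b - w) ^ (d - 1) \<le> vabs l * M ^ (d - 1)"
    using M_le[OF assms(7)] by (intro mult_left_mono power_mono) auto
  then have gtM: "vabs l * M ^ (d - 1) > 1" using gt by simp
  have M: "M > 0"
    using gtM b'(2) vabs_nonneg[of "b' - w"] size(2)
    by (cases "M = 0") (auto simp: d_def power_0_left)
  have escape: "vabs (poly \<phi> z - w) > vabs (z - w)" if "vabs (z - w) > M" for z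
    using that M gtM size M_le by (intro poly_escapes[OF fac]) (auto simp: l_def d_def)
  have crit: "vabs (poly \<phi> z - w) \<le> M" if "poly (pderiv \<phi>) z = 0" for z
  proof (rule ccontr)
    let ?O = "range (\<lambda>n. (poly \<phi> ^^ n) (poly \<phi> z))"
    assume "\<not> vabs (poly \<phi> z - w) \<le> M"
    then have "strict_mono (\<lambda>n. vabs ((poly \<phi> ^^ n) (poly \<phi> z) - w))"
      using escape by (intro strict_mono_escaping_orbit) auto
    then have "infinite (range (\<lambda>n. vabs ((poly \<phi> ^^ n) (poly \<phi> z) - w)))"
      using strict_mono_imp_inj_on range_inj_infinite by blast
    moreover have "range (\<lambda>n. vabs ((poly \<phi> ^^ n) (poly \<phi> z) - w)) = (\<lambda>y. vabs (y - w)) ` ?O"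
      by auto
    ultimately have "infinite ?O" by (metis finite_imageI)
    then have "infinite (Finite ` ?O)" by (simp add: finite_image_iff inj_on_def)
    \<comment> \<open>The orbit of the critical value is that of the critical point, shifted by
      one.\<close>
    moreover have "Finite ` ?O \<subseteq> range (\<lambda>n. (rat_apply (poly_map \<phi>) ^^ n) (Finite z))"
    proof safe
      fix n
      have "Finite ((poly \<phi> ^^ n) (poly \<phi> z)) = (rat_apply (poly_map \<phi>) ^^ Suc n) (Finite z)"
        by (simp add: funpow_Suc_right del: funpow.simps)
      then show "Finite ((poly \<phi> ^^ n) (poly \<phi> z)) \<in> range (\<lambda>n. (rat_apply (poly_map \<phi>) ^^ n) (Finite z))"
        by blast
    qed
    ultimately show False
      using pcf that critical_point_poly_map finite_subset unfolding post_critically_finite_def by blast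
  qed
  obtain a r where ar: "r > 0" "vabs l * r ^ d = M"
      "\<And>z. vabs (poly \<phi> z - w) \<le> M \<longleftrightarrow> vabs (z - a) \<le> r"
    using disk M crit unfolding disk_preimage_def l_def d_def by metis
  have near: "vabs (x - a) \<le> r" if "x \<in># A" for x
  proof -
    have "poly (\<phi> - [:w:]) x = 0"
      unfolding fac using that by (auto simp: poly_prod_linear prod_mset_zero_iff)
    then show ?thesis using M by (simp flip: ar(3))
  qed
  \<comment> \<open>Both \<open>w\<close> and the farthest root \<open>b'\<close> lie in the disk of
    radius \<open>r\<close>.\<close>
  then have "M \<le> r"
    using vabs_diff_trans[of b' a r w] near[OF b'(1)] near[OF assms(6)] b'(2)
    by (simp add: vabs_minus_commute[of a w])
  then have "vabs l * M ^ d \<le> M"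
    using M mult_left_mono[OF power_mono[of M r d], of "vabs l"] by (simp add: ar(2))
  moreover have "M ^ d = M ^ (d - 1) * M" using size(2) by (cases d) (auto simp: d_def)
  ultimately have "(vabs l * M ^ (d - 1)) * M \<le> 1 * M" by (simp add: mult.assoc)
  then show False using M gtM by simp
qed

section \<open>Affine conjugation, good reduction and the point at infinity\<close>

lemma hom_subst_affine: "hom_subst (degree F) F a b 0 1 = pcompose F [:b, a:]"
  by (simp add: hom_subst_def pcompose_altdef poly_altdef coeff_map_poly degree_map_poly
      flip: one_pCons)

lemma hom_subst_1 [simp]: "hom_subst d 1 a b c e = [:e, c:] ^ d"
proof -
  have "hom_subst d 1 a b c e = (\<Sum>i\<le>d. if i = 0 then [:e, c:] ^ d else 0)"
    unfolding hom_subst_def by (intro sum.cong) auto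
  then show ?thesis by simp
qed

text \<open>Conjugation by \<open>w + \<alpha> z\<close> produces pairs with this common factor
  \<alpha>. Dividing it out leaves \<open>(h, 1)\<close>, and a monic \<open>h\<close> keeps its
  degree under reduction.\<close>

lemma good_reduction_monic:
  fixes h :: "'a::nonarch_field poly"
  assumes "integral_poly h" "lead_coeff h = 1" "\<alpha> \<noteq> 0"
  shows "good_reduction (smult \<alpha> h, [:\<alpha>:])"
  unfolding good_reduction_def
proof (intro exI conjI)
  have eq: "map_prod (smult (inverse \<alpha>)) (smult (inverse \<alpha>)) (smult \<alpha> h, [:\<alpha>:]) = (h, 1)"
    using assms(3) by (simp add: one_pCons)
  show "inverse \<alpha> \<noteq> 0" using assms(3) by simp
  have "is_unit [:\<alpha>:]" using assms(3) by (simp add: is_unit_const_poly_iff dvd_field_iff)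
  then have "coprime (smult \<alpha> h) [:\<alpha>:]" by (rule is_unit_right_imp_coprime)
  then show "has_degree (smult \<alpha> h, [:\<alpha>:]) (degree h)"
    unfolding has_degree_def using assms(3)
    by (intro exI[of _ 1] exI[of _ "smult \<alpha> h"] exI[of _ "[:\<alpha>:]"]) simp
  have "vabs (coeff 1 i) \<le> 1" for i
    using integral_poly_1 unfolding integral_poly_def by blast
  then show "normalized (map_prod (smult (inverse \<alpha>)) (smult (inverse \<alpha>)) (smult \<alpha> h, [:\<alpha>:]))"
    unfolding eq normalized_def using assms(1)
    by (auto simp: integral_poly_def intro!: exI[of _ 0])
  have "degree (red_poly h) = degree h"
  proof (rule antisym)
    show "degree h \<le> degree (red_poly h)"
      using assms(2) by (intro le_degree) (simp add: coeff_map_poly)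
  qed (simp add: degree_le coeff_map_poly coeff_eq_0)
  moreover have "red_poly 1 = (1 :: 'a residue_field poly)"
    by (simp add: one_pCons red_poly_pCons)
  ultimately show "has_degree (reduction (map_prod (smult (inverse \<alpha>)) (smult (inverse \<alpha>)) (smult \<alpha> h, [:\<alpha>:])))
      (degree h)"
    unfolding eq has_degree_def reduction_def
    by (intro exI[of _ 1] exI[of _ "red_poly h"]) simp
qed

lemma degree_poly_iter: "degree (poly_iter \<phi> n) = degree \<phi> ^ n"
  for \<phi> :: "'a::idom poly"
  by (induction n) (simp_all add: poly_iter_def poly_comp_def degree_pcompose)

text \<open>In the coordinate \<open>1 / z\<close> the numerator is, up to sign, a power of the
  variable with exponent at least 2. It vanishes doubly at 0, and so the Wronskian vanishes
  there.\<close>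

lemma multiplier_Infinity:
  fixes \<phi> :: "'a::field poly"
  assumes "degree \<phi> \<ge> 2" "n > 0"
  shows "multiplier \<phi> n Infinity = 0"
proof -
  define F e where "F = poly_iter \<phi> n" and "e = degree F"
  define G where "G = hom_subst e F 0 1 1 0"
  have "e \<ge> 2 ^ n"
    unfolding e_def F_def degree_poly_iter using assms by (intro power_mono) auto
  moreover have "2 ^ 1 \<le> (2 :: nat) ^ n" using assms(2) by (intro power_increasing) auto
  ultimately have e: "e \<ge> 2" by simp
  have "at_infinity_chart (F, 1) = (- ([:0, 1:] ^ e), - G)"
    by (simp add: e_def[symmetric] G_def Let_def)
  moreover have "poly ([:0, 1:] ^ e) 0 = (0 :: 'a)" "poly (pderiv ([:0, 1:] ^ e)) 0 = (0 :: 'a)"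
    using e by (simp_all add: pderiv_power)
  ultimately have "poly (wronskian (at_infinity_chart (F, 1))) 0 = 0"
    by (simp add: pderiv_minus)
  then show ?thesis by (simp add: multiplier_def poly_map_def F_def)
qed

theorem theorem7p1:
  fixes \<phi> :: "'a::nonarch_field poly" and d p :: nat
  assumes "p = CHAR('a residue_field)"
    and "degree \<phi> = d" and "d \<ge> 2"
    and "CHAR('a) = 0 \<or> CHAR('a) > d"
    and "post_critically_finite (poly_map \<phi>)"
    and "p = 0 \<or> (\<exists>fs. (\<forall>f\<in>set fs. degree f < p) \<and> \<phi> = poly_comp fs)"
  shows "potentially_good_reduction (poly_map \<phi>) \<and> \<not> has_repelling_cycle \<phi>"
proof -
  have tame: "tame f" if "degree f > 0" "p = 0 \<or> degree f < p" for f :: "'a poly"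
    using that by (auto simp: tame_def of_nat_eq_0_iff_char_dvd assms(1) dest: dvd_imp_le)
  have disk: "disk_preimage \<phi>"
    using assms(6)
  proof
    assume "p = 0"
    then show ?thesis using assms(2,3) by (intro tame_disk_preimage tame) auto
  next
    assume "\<exists>fs. (\<forall>f\<in>set fs. degree f < p) \<and> \<phi> = poly_comp fs"
    then obtain fs where fs: "\<forall>f\<in>set fs. degree f < p" "\<phi> = poly_comp fs" by blast
    show ?thesis unfolding fs(2)
      by (rule disk_preimage_poly_comp) (use fs assms(2,3) tame in auto)
  qed
  define l where "l = lead_coeff \<phi>"
  have l: "l \<noteq> 0" using assms(2,3) by (auto simp: l_def)
  \<comment> \<open>A root of this polynomial is a fixed point; the degree is positive since
    \<open>d \<ge> 2\<close>.\<close>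
  have "degree (\<phi> + - [:0, 1:]) = d"
    using assms(2,3) by (subst degree_add_eq_left) auto
  then obtain w where w: "poly \<phi> w = w"
    using alg_closed_imp_poly_has_root[of "\<phi> + - [:0, 1:]"] assms(3) by auto
  obtain A where A: "size A = d" "\<phi> - [:w:] = smult l (\<Prod>x\<in>#A. [:- x, 1:])"
    using poly_factorization_value[of \<phi> w] assms(2,3) by (auto simp: l_def)
  have wA: "w \<in># A"
  proof -
    have "poly (\<phi> - [:w:]) w = 0" using w by simp
    then show ?thesis unfolding A(2) using l by (auto simp: poly_prod_linear prod_mset_zero_iff)
  qed
  \<comment> \<open>This scaling makes the conjugate of \<phi> by \<open>w + \<alpha> z\<close>
    monic.\<close>
  obtain \<alpha> where \<alpha>: "\<alpha> ^ (d - 1) = inverse l"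
    using nth_root_exists[of "d - 1" "inverse l"] assms(3) by auto
  have \<alpha>0: "\<alpha> \<noteq> 0" using \<alpha> l assms(3) by (auto simp: power_0_left)
  have l\<alpha>: "l * \<alpha> ^ (d - 1) = 1"
    unfolding \<alpha> using l by simp
  have "\<alpha> ^ d = \<alpha> ^ (d - 1) * \<alpha>" using assms(3) by (cases d) auto
  then have \<alpha>l: "l * \<alpha> ^ d = \<alpha>"
    using l\<alpha> by (metis mult.assoc mult_1)
  have vl: "vabs l * vabs \<alpha> ^ (d - 1) = 1"
    using arg_cong[OF l\<alpha>, of vabs] by (simp add: vabs_mult vabs_power)
  have roots: "vabs (x - w) \<le> vabs \<alpha>" if "x \<in># A" for x
  proof -
    have "vabs l * vabs (x - w) ^ (d - 1) \<le> vabs l * vabs \<alpha> ^ (d - 1)"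
      using pcf_root_bound[OF disk assms(5) A(2)[unfolded l_def] _ _ wA that] A(1) assms(2,3)
      unfolding vl by (simp add: l_def)
    then have "vabs (x - w) ^ (d - 1) \<le> vabs \<alpha> ^ (d - 1)"
      using l by (simp add: vabs_pos_iff)
    then show ?thesis using assms(3) by (subst (asm) power_mono_iff) auto
  qed
  \<comment> \<open>This is the conjugate \<open>(\<phi>(w + \<alpha> z) - w) / \<alpha>\<close>;
    its roots are integral by \<open>roots\<close>.\<close>
  define h where "h = (\<Prod>x\<in>#image_mset (\<lambda>x. (x - w) / \<alpha>) A. [:- x, 1:])"
  have h: "pcompose (\<phi> - [:w:]) [:w, \<alpha>:] = smult \<alpha> h"
    unfolding A(2) pcompose_smult pcompose_prod_linear[OF \<alpha>0]
    by (simp add: h_def A(1) \<alpha>l)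
  have int: "integral_poly h"
    unfolding h_def using roots \<alpha>0
    by (intro integral_poly_prod_linear) (auto simp: vabs_divide divide_le_eq_1 vabs_pos_iff)
  have "rat_conj \<alpha> w 0 1 (poly_map \<phi>) = (smult \<alpha> h, [:\<alpha>:])"
    by (simp add: poly_map_def Let_def hom_subst_affine pcompose_diff pcompose_const
        flip: h one_pCons)
  moreover have "good_reduction (smult \<alpha> h, [:\<alpha>:])"
    using int \<alpha>0 unfolding h_def by (intro good_reduction_monic lead_coeff_prod_linear) auto
  ultimately have "potentially_good_reduction (poly_map \<phi>)"
    unfolding potentially_good_reduction_def using \<alpha>0
    by (intro exI[of _ \<alpha>] exI[of _ w] exI[of _ 0] exI[of _ 1]) simp
  moreover have "\<not> has_repelling_cycle \<phi>"
  proof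
    assume "has_repelling_cycle \<phi>"
    then obtain n P where n: "has_exact_period (rat_apply (poly_map \<phi>)) P n"
      and rep: "vabs (multiplier \<phi> n P) > 1" by (auto simp: has_repelling_cycle_def)
    have n0: "n > 0" using n by (simp add: has_exact_period_def)
    show False
    proof (cases P)
      case Infinity
      then show False using rep multiplier_Infinity[of \<phi> n] n0 assms(2,3) by simp
    next
      case (Finite z)
      have per: "(poly \<phi> ^^ n) z = z" using n Finite by (simp add: has_exact_period_def)
      have escape: "vabs (poly \<phi> z - w) > vabs (z - w)" if "vabs (z - w) > vabs \<alpha>" for z
        using that A(1) assms(3) roots vl by (intro poly_escapes[OF A(2)]) auto
      \<comment> \<open>Outside the disk the distance to \<open>w\<close> grows strictly along the
        orbit, but each point of the cycle returns after \<open>n\<close> steps.\<close>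
      have inside: "vabs ((poly \<phi> ^^ k) z - w) \<le> vabs \<alpha>" for k
      proof (rule ccontr)
        assume "\<not> ?thesis"
        then have "strict_mono (\<lambda>m. vabs ((poly \<phi> ^^ m) ((poly \<phi> ^^ k) z) - w))"
          using escape by (intro strict_mono_escaping_orbit) auto
        then have "vabs ((poly \<phi> ^^ n) ((poly \<phi> ^^ k) z) - w) > vabs ((poly \<phi> ^^ k) z - w)"
          using n0 by (auto dest: strict_monoD)
        moreover have "(poly \<phi> ^^ n) ((poly \<phi> ^^ k) z) = (poly \<phi> ^^ k) ((poly \<phi> ^^ n) z)"
          by (simp add: add.commute flip: funpow_add[THEN fun_cong, unfolded o_apply])
        ultimately show False by (simp add: per)
      qed
      have deriv: "vabs (poly (pderiv \<phi>) y) \<le> 1" if "vabs (y - w) \<le> vabs \<alpha>" for y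
      proof -
        define u where "u = (y - w) / \<alpha>"
        have u: "w + \<alpha> * u = y" "vabs u \<le> 1"
          using that \<alpha>0 by (auto simp: u_def vabs_divide divide_le_eq_1 vabs_pos_iff)
        \<comment> \<open>Affine conjugation preserves derivatives at corresponding points, so
          integrality of \<open>h\<close> bounds that of \<phi> on the whole disk. The chain rule
          along the cycle then bounds the multiplier.\<close>
        have "\<alpha> * poly (pderiv \<phi>) y = \<alpha> * poly (pderiv h) u"
          using arg_cong[OF h, of "\<lambda>q. poly (pderiv q) u"] u(1)
          by (simp add: pderiv_pcompose poly_pcompose pderiv_diff pderiv_pCons pderiv_smult mult.commute)
        then have "poly (pderiv \<phi>) y = poly (pderiv h) u" using \<alpha>0 by simp
        then show ?thesis using u(2) int by (simp add: vabs_poly_le integral_poly_pderiv)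
      qed
      have "vabs (poly (pderiv (poly_iter \<phi> k)) z) \<le> 1" for k
      proof (induction k)
        case 0
        show ?case by (simp add: poly_iter_def poly_comp_def pderiv_pCons)
      next
        case (Suc k)
        have "poly_iter \<phi> (Suc k) = pcompose \<phi> (poly_iter \<phi> k)"
          by (simp add: poly_iter_def poly_comp_def)
        then show ?case
          using Suc deriv[OF inside[of k]]
          by (simp add: pderiv_pcompose poly_pcompose poly_poly_iter vabs_mult mult_le_one)
      qed
      then show False using rep Finite by (simp add: not_less[symmetric])
    qed
  qed
  ultimately show ?thesis by blast
qed

end
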